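(* For every integer $m\ge 0$, \begin{align*} &\zeta(4m+3)-\frac{2}{1-2^{-4m-3}}\sum_{j=1}^{\infty}\frac{(2j-1)^{-4m-3}}{e^{(2j-1)\pi}+1}\\ &=-\frac{2^{4m+2}\pi^{4m+3}}{2^{4m+3}-1}\sum_{j=1}^{2m+1}\frac{(-1)^jB_{2j}B_{4m-2j+4}}{(2j)!(4m-2j+4)!}(2^{2j}-1)(2^{4m-2j+4}-1). \end{align*}
   Context: $\zeta$ is the Riemann zeta function and $B_{n}$ are the Bernoulli numbers, defined by $\frac{z}{e^z-1}=\sum_{n\ge0}B_n\frac{z^n}{n!}$ for $|z|<2\pi$. *)

theory Defs
  imports "HOL-Complex_Analysis.Complex_Analysis"
begin

text \<open>The Riemann zeta function: the Dirichlet series for \<open>Re s > 1\<close>, and elsewhere the value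
  of the holomorphic continuation to the plane without \<open>1\<close>, which is unique by the identity
  theorem. The value at the pole \<open>s = 1\<close> is unspecified. The term with index \<open>n\<close> of the
  series is \<open>(n + 1) powr - s\<close>.\<close>

definition zeta_series :: "complex \<Rightarrow> complex" where
  "zeta_series s = (\<Sum>n. of_nat (Suc n) powr - s)"

definition zeta :: "complex \<Rightarrow> complex" where
  "zeta s = (if Re s > 1 then zeta_series s
     else (THE w. \<exists>f. f holomorphic_on - {1} \<and> (\<forall>z. Re z > 1 \<longrightarrow> f z = zeta_series z) \<and> f s = w))"

text \<open>The point \<open>z = 0\<close> is excluded because \<open>z / (exp z - 1)\<close> has a removable singularity there,
  whereas \<open>0 / 0 = 0\<close> in HOL. The lemmas after the definition show that exactly one sequence has
  the defining property.\<close>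

definition bernoulli_gf :: "(nat \<Rightarrow> real) \<Rightarrow> bool" where
  "bernoulli_gf B \<longleftrightarrow> (\<forall>z::complex. z \<noteq> 0 \<and> norm z < 2 * pi \<longrightarrow>
     (\<lambda>n. of_real (B n) * z ^ n / fact n) sums (z / (exp z - 1)))"

definition bernoulli :: "nat \<Rightarrow> real" where
  "bernoulli = (THE B. bernoulli_gf B)"

lemma exp_eq_1_norm_less:
  fixes z :: complex
  assumes "exp z = 1" "norm z < 2 * pi"
  shows "z = 0"
proof -
  from assms(1) obtain n :: int where n: "Re z = 0" "Im z = of_int (2 * n) * pi"
    by (auto simp: exp_eq_1)
  have "\<bar>Im z\<bar> < 2 * pi"
    using abs_Im_le_cmod[of z] assms(2) by linarith
  hence "\<bar>real_of_int n\<bar> * (2 * pi) < 1 * (2 * pi)"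
    using n by (simp add: abs_mult mult_ac)
  hence "\<bar>real_of_int n\<bar> < 1"
    by (simp only: mult_less_cancel_right) auto
  hence "n = 0" by linarith
  thus ?thesis using n by (simp add: complex_eq_iff)
qed

lemma bernoulli_gf_fps:
  "bernoulli_gf (\<lambda>n. fact n * fps_nth (fps_X / (fps_exp 1 - 1)) n)"
proof -
  define R :: "real fps" where "R = fps_X / (fps_exp 1 - 1)"
  define G :: "complex fps" where "G = Abs_fps (\<lambda>n. of_real (fps_nth R n))"
  define f where "f = (\<lambda>z::complex. if z = 0 then 1 else z / (exp z - 1))"
  have sd1: "subdegree (fps_exp 1 - 1 :: real fps) = 1"
    by (rule subdegreeI) auto
  have nz1: "fps_exp 1 - 1 \<noteq> (0 :: real fps)" using sd1 by auto
  have sd2: "subdegree (fps_exp 1 - 1 :: complex fps) = 1"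
    by (rule subdegreeI) auto
  have nz2: "fps_exp 1 - 1 \<noteq> (0 :: complex fps)" using sd2 by auto
  have "(fps_exp 1 - 1) dvd (fps_X :: real fps)"
    using nz1 sd1 by (subst fps_dvd_iff) auto
  hence RX: "R * (fps_exp 1 - 1) = fps_X"
    unfolding R_def by simp
  have "G * (fps_exp 1 - 1) = fps_X"
  proof (rule fps_ext)
    fix n
    have "fps_nth (G * (fps_exp 1 - 1)) n = of_real (fps_nth (R * (fps_exp 1 - 1)) n)"
      by (auto simp: fps_mult_nth G_def fps_one_def intro!: sum.cong)
    also have "\<dots> = fps_nth fps_X n" by (simp add: RX fps_X_def)
    finally show "fps_nth (G * (fps_exp 1 - 1)) n = fps_nth fps_X n" .
  qed
  hence G: "G = fps_X / (fps_exp 1 - 1)"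
    using nz2 by (metis nonzero_mult_div_cancel_right)
  have ex: "(\<lambda>z::complex. exp z - 1) has_fps_expansion (fps_exp 1 - 1)"
    by (intro fps_expansion_intros)
  have "(\<lambda>z::complex. if z = 0 then 1 else z / (exp z - 1)) 
     has_fps_expansion (fps_X / (fps_exp 1 - 1))"
    using sd2 nz2 by (intro has_fps_expansion_divide ex fps_expansion_intros) auto
  hence fG: "f has_fps_expansion G" by (simp add: f_def G)
  have "f holomorphic_on eball 0 (ereal (2 * pi))"
  proof -
    have ball: "eball 0 (ereal (2 * pi)) = ball (0::complex) (2 * pi)" by (simp add: eball_def ball_def)
    have "f holomorphic_on ball 0 (2 * pi) - {0}"
    proof -
      have "(\<lambda>z. z / (exp z - 1)) holomorphic_on ball 0 (2 * pi) - {0}"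
        using exp_eq_1_norm_less by (intro holomorphic_intros) auto
      thus ?thesis
        by (rule holomorphic_transform) (auto simp: f_def)
    qed
    moreover have "isCont f 0"
      using fG has_fps_expansion_imp_continuous by blast
    ultimately have "f holomorphic_on ball 0 (2 * pi)"
      by (intro no_isolated_singularity'[of "{0}" f "ball 0 (2*pi)"])
         (auto simp: isCont_def intro: tendsto_within_subset)
    thus ?thesis by (simp add: ball)
  qed
  hence sums: "(\<lambda>n. fps_nth G n * z ^ n) sums f z" if "norm z < 2 * pi" for z
    using has_fps_expansion_imp_sums_complex[OF fG, of "ereal (2 * pi)" z] that by (simp add: in_eball_iff)
  show ?thesis
    unfolding bernoulli_gf_def
  proof safe
    fix z :: complex assume "z \<noteq> 0" "norm z < 2 * pi"
    thus "(\<lambda>n. of_real (fact n * fps_nth (fps_X / (fps_exp 1 - 1)) n) * z ^ n / fact n)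
            sums (z / (exp z - 1))"
      using sums[of z] by (simp add: f_def G_def flip: R_def)
  qed
qed

lemma bernoulli_gf_unique:
  assumes "bernoulli_gf A" "bernoulli_gf B"
  shows "A = B"
proof
  fix n
  define c where "c = (\<lambda>n. complex_of_real (A n - B n) / fact n)"
  have c: "(\<lambda>n. c n * z ^ n) sums (if z = 0 then c 0 else 0)" if "norm z < 2 * pi" for z
  proof (cases "z = 0")
    case True
    thus ?thesis using powser_sums_zero[of c] by simp
  next
    case False
    have "(\<lambda>n. of_real (A n) * z ^ n / fact n - of_real (B n) * z ^ n / fact n) sums
            (z / (exp z - 1) - z / (exp z - 1))"
      using assms that False unfolding bernoulli_gf_def by (intro sums_diff) auto
    moreover have "(\<lambda>n. of_real (A n) * z ^ n / fact n - of_real (B n) * z ^ n / fact n) =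
        (\<lambda>n. c n * z ^ n)"
      by (auto simp: c_def field_simps)
    ultimately show ?thesis using False by simp
  qed
  let ?f = "\<lambda>z::complex. if z = 0 then c 0 else (0::complex)"
  have "(?f \<longlongrightarrow> c 0) (at 0)"
    using c by (intro powser_limit_0[of "2*pi" c ?f]) auto
  moreover have "(?f \<longlongrightarrow> 0) (at 0)"
    by (rule Lim_transform_eventually[of "\<lambda>_. 0"]) (auto simp: eventually_at_filter)
  ultimately have "c 0 = 0"
    using LIM_unique by blast
  hence s: "(\<lambda>n. c n * z ^ n) sums 0" if "norm z < 2 * pi" for z
    using c[OF that] by (simp split: if_splits)
  have "(\<lambda>z. 0) has_fps_expansion Abs_fps c"
  proof -
    have "fps_conv_radius (Abs_fps c) \<ge> ereal 1"
      unfolding fps_conv_radius_def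
    proof (rule conv_radius_geI_ex)
      fix r :: real assume "0 < r" "ereal r < ereal 1"
      hence "norm (complex_of_real r) < 2 * pi" using pi_gt3 by simp
      thus "\<exists>z. norm z = r \<and> summable (\<lambda>n. fps_nth (Abs_fps c) n * z ^ n)"
        using s[of "of_real r"] \<open>0 < r\<close> by (intro exI[of _ "of_real r"]) (auto simp: sums_iff)
    qed
    hence "fps_conv_radius (Abs_fps c) > 0" by (metis ereal_less(2) less_le_trans zero_less_one)
    moreover have "eventually (\<lambda>z::complex. z \<in> ball 0 1) (nhds 0)"
      by (intro eventually_nhds_in_open) auto
    hence "eventually (\<lambda>z. eval_fps (Abs_fps c) z = 0) (nhds 0)"
    proof eventually_elim
      case (elim z)
      hence "norm z < 2 * pi" using pi_gt3 by simp
      from s[OF this] show ?case by (simp add: eval_fps_def sums_iff)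
    qed
    ultimately show ?thesis by (simp add: has_fps_expansion_def)
  qed
  hence "Abs_fps c = 0"
    using has_fps_expansion_0 by (rule fps_expansion_unique_complex)
  hence "c n = 0" by (metis fps_nth_Abs_fps fps_zero_nth)
  thus "A n = B n" by (simp add: c_def flip: of_real_diff)
qed

lemma bernoulli_eq_fps: "bernoulli n = fact n * fps_nth (fps_X / (fps_exp 1 - 1)) n"
  using the_equality[of bernoulli_gf, OF bernoulli_gf_fps bernoulli_gf_unique[OF _ bernoulli_gf_fps]]
  by (simp add: bernoulli_def)

lemma bernoulli_gf_bernoulli: "bernoulli_gf bernoulli"
  using bernoulli_gf_fps unfolding bernoulli_eq_fps[symmetric] .

end

theory Submission
  imports Defs
begin

text \<open>Since \<open>1 - 2 / (e\<^sup>y + 1) = tanh (y / 2)\<close>, the claim is equivalent to an evaluation of the series of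
  \<open>tanh (\<pi> n / 2) / n\<^bsup>4m + 3\<^esup>\<close> over odd \<open>n\<close>. The expansion of \<open>tanh\<close> into partial fractions, obtained from
  the reflection formula of the Digamma function, turns it into the double series of
  \<open>(4 / \<pi>) / (a\<^bsup>N\<^esup> (a + b))\<close> with \<open>a = n\<^sup>2\<close>, \<open>b = k\<^sup>2\<close> for odd \<open>n\<close>, \<open>k\<close>, and \<open>N = 2m + 1\<close>. As \<open>N\<close> is odd, \<open>a + b\<close>
  divides \<open>a\<^bsup>N\<^esup> + b\<^bsup>N\<^esup>\<close>; symmetrising in \<open>a\<close> and \<open>b\<close> therefore leaves a finite sum of products of
  two series over odd numbers with even exponents. Euler's formula expresses these by Bernoulli numbers.\<close>

section \<open>Partial fractions of tanh and coth via the Digamma function\<close>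

text \<open>Differentiate both sides of
  \<open>rGamma z * rGamma (1 - z) = sin (pi * z) / pi\<close>. The left derivative is the product
  itself times a difference of Digamma values, so dividing by the sine, which is nonzero off the
  integers, leaves the cotangent.\<close>

lemma Digamma_reflection:
  fixes z :: complex
  assumes "z \<notin> \<int>"
  shows "Digamma (1 - z) - Digamma z = of_real pi * cot (of_real pi * z)"
proof -
  let ?p = "of_real pi :: complex"
  have z1: "1 - z \<notin> \<int>"
    using assms Ints_diff[OF Ints_1, of "1 - z"] by auto
  have nz: "z \<notin> \<int>\<^sub>\<le>\<^sub>0" "1 - z \<notin> \<int>\<^sub>\<le>\<^sub>0"
    using assms z1 nonpos_Ints_subset_Ints by blast+
  have sin: "sin (?p * z) \<noteq> 0"
    using assms by (auto simp: sin_eq_0 mult.commute)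
  have "((\<lambda>z. rGamma z * rGamma (1 - z)) has_field_derivative
          - (rGamma z * rGamma (1 - z)) * (Digamma z - Digamma (1 - z))) (at z)"
    using nz by (auto intro!: derivative_eq_intros simp: algebra_simps)
  moreover have "((\<lambda>z. sin (?p * z) / ?p) has_field_derivative cos (?p * z)) (at z)"
    by (auto intro!: derivative_eq_intros)
  ultimately have "cos (?p * z) = - (sin (?p * z) / ?p) * (Digamma z - Digamma (1 - z))"
    unfolding rGamma_reflection_complex by (rule DERIV_unique[symmetric])
  thus ?thesis using sin by (simp add: cot_def field_simps)
qed

text \<open>Subtracting the defining series of two Digamma values cancels the Euler-Mascheroni
  constant and the terms 1/(n+1).\<close>

lemma sums_Digamma_diff:
  fixes w z :: "'a :: {real_normed_field, banach}"
  assumes "w \<noteq> 0" "z \<noteq> 0"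
  shows "(\<lambda>n. inverse (w + of_nat n) - inverse (z + of_nat n)) sums (Digamma z - Digamma w)"
  using sums_diff[OF summable_sums[OF summable_Digamma[OF assms(2)]]
                     summable_sums[OF summable_Digamma[OF assms(1)]]]
  by (simp add: Digamma_def)

text \<open>The points 1/2 + w and 1/2 - w with w = ix/2 are exchanged by z -> 1 - z, so reflection
  evaluates the difference of their Digamma values, and cot(pi/2 + iy) = -i tanh y makes the result
  real up to a factor i.\<close>

lemma tanh_partial_fractions:
  fixes x :: real
  assumes "x \<noteq> 0"
  shows "(\<lambda>n. 1 / ((2 * real n + 1)\<^sup>2 + x\<^sup>2)) sums (pi * tanh (pi * x / 2) / (4 * x))"
proof -
  define w where "w = \<i> * complex_of_real x / 2"
  have Im: "Im w \<noteq> 0" using assms by (simp add: w_def)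
  have notint: "1 / 2 + w \<notin> \<int>"
    using Im by (auto elim!: Ints_cases simp: complex_eq_iff)
  have ne: "1 / 2 + w \<noteq> 0" "1 / 2 - w \<noteq> 0"
    using Im by (auto simp: complex_eq_iff)
  have nz: "1 / 2 + w + of_nat n \<noteq> 0" "1 / 2 - w + of_nat n \<noteq> 0" for n :: nat
    using Im by (auto simp: complex_eq_iff)
  \<comment> \<open>The two denominators multiply to ((2n+1)^2 + x^2)/4 and the numerator is 2w =
    ix; this is the source of the factor 4ix, cancelled at the end.\<close>
  have summand: "inverse (1 / 2 - w + of_nat n) - inverse (1 / 2 + w + of_nat n) =
          of_real (1 / ((2 * real n + 1)\<^sup>2 + x\<^sup>2)) * (4 * \<i> * x)" for n
  proof -
    have pos: "(2 * real n + 1)\<^sup>2 + x\<^sup>2 \<noteq> 0"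
      using assms by (simp add: sum_power2_eq_zero_iff)
    hence pos': "complex_of_real ((2 * real n + 1)\<^sup>2 + x\<^sup>2) \<noteq> 0"
      by (simp only: of_real_eq_0_iff not_False_eq_True)
    have prod: "(1 / 2 - w + of_nat n) * (1 / 2 + w + of_nat n) = of_real ((2 * real n + 1)\<^sup>2 + x\<^sup>2) / 4"
      by (simp add: w_def field_simps power2_eq_square)
    have "inverse (1 / 2 - w + of_nat n) - inverse (1 / 2 + w + of_nat n) =
      2 * w / ((1 / 2 - w + of_nat n) * (1 / 2 + w + of_nat n))"
      using nz[of n] by (simp add: divide_simps)
    thus ?thesis unfolding prod using pos' by (simp add: w_def)
  qed
  have "Digamma (1 / 2 + w) - Digamma (1 / 2 - w) = - of_real pi * cot (of_real pi * (1 / 2 + w))"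
    using Digamma_reflection[OF notint] by (simp add: algebra_simps)
  also have "of_real pi * (1 / 2 + w) = of_real pi / 2 + \<i> * of_real (pi * x / 2)"
    by (simp add: w_def algebra_simps)
  also have "cot \<dots> = - \<i> * of_real (tanh (pi * x / 2))"
  proof -
    define y where "y = pi * x / 2"
    have "sin (\<i> * complex_of_real y) = \<i> * of_real (sinh y)"
         "cos (\<i> * complex_of_real y) = of_real (cosh y)"
      by (simp_all add: sin_exp_eq cos_exp_eq sinh_field_def cosh_field_def exp_of_real exp_minus field_simps)
    thus ?thesis unfolding y_def[symmetric]
      by (simp add: cot_def sin_add cos_add tanh_def)
  qed
  finally have "Digamma (1 / 2 + w) - Digamma (1 / 2 - w) =
      of_real (pi * tanh (pi * x / 2) / (4 * x)) * (4 * \<i> * x)"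
    using assms by simp
  hence "(\<lambda>n. of_real (1 / ((2 * real n + 1)\<^sup>2 + x\<^sup>2)) * (4 * \<i> * x)) sums
     (of_real (pi * tanh (pi * x / 2) / (4 * x)) * (4 * \<i> * x))"
    using sums_Digamma_diff[OF ne(2,1)] by (simp only: summand)
  hence "(\<lambda>n. complex_of_real (1 / ((2 * real n + 1)\<^sup>2 + x\<^sup>2))) sums
     of_real (pi * tanh (pi * x / 2) / (4 * x))"
    using assms by (subst (asm) sums_mult2_iff) auto
  thus ?thesis by (simp only: sums_of_real_iff)
qed

text \<open>The right-hand side is (z/2) coth(z/2) - 1, the Bernoulli generating function without
  its terms of degree 0 and 1. Reflection at s = z/(2 pi i) gives the cotangent, and the shift from
  s to 1 + s contributes the -1.\<close>

lemma coth_partial_fractions: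
  fixes z :: complex
  assumes "z \<noteq> 0" "norm z < 2 * pi"
  shows "(\<lambda>n. 2 * z\<^sup>2 / (z\<^sup>2 + (2 * pi * real (Suc n))\<^sup>2)) sums (z / (exp z - 1) + z / 2 - 1)"
proof -
  define s where "s = - \<i> * z / (2 * pi)"
  have s0: "s \<noteq> 0" and ns: "norm s < 1" using assms by (auto simp: s_def norm_mult norm_divide)
  have notint: "s \<notin> \<int>"
    using s0 ns by (auto elim!: Ints_cases)
  have "1 + s \<noteq> 0" "1 - s \<noteq> 0"
    using ns by (auto simp: add_eq_0_iff)
  have nz: "of_nat (Suc n) + s \<noteq> 0" "of_nat (Suc n) - s \<noteq> 0" for n
  proof -
    have "norm (of_nat (Suc n) :: complex) \<ge> 1"
      by (simp only: norm_of_nat)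
    hence "s \<noteq> - of_nat (Suc n)" "s \<noteq> of_nat (Suc n)"
      using ns by (auto simp del: of_nat_Suc)
    thus "of_nat (Suc n) + s \<noteq> 0" "of_nat (Suc n) - s \<noteq> 0"
      by (auto simp: add_eq_0_iff simp del: of_nat_Suc)
  qed
  have e: "exp z \<noteq> 1" using exp_eq_1_norm_less assms by blast
  have summand: "z / (2 * pi * \<i>) * (inverse (1 + s + of_nat n) - inverse (1 - s + of_nat n)) =
     2 * z\<^sup>2 / (z\<^sup>2 + (2 * pi * real (Suc n))\<^sup>2)" for n
  proof -
    have prod: "(of_nat (Suc n) + s) * (of_nat (Suc n) - s) = 
        (z\<^sup>2 + (2 * pi * real (Suc n))\<^sup>2) / (2 * pi)\<^sup>2"
      by (simp add: s_def field_simps power2_eq_square)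
    have "inverse (1 + s + of_nat n) - inverse (1 - s + of_nat n) =
       inverse (of_nat (Suc n) + s) - inverse (of_nat (Suc n) - s)"
      by (simp add: add_ac diff_add_eq add_diff_eq)
    also have "\<dots> = - 2 * s / ((of_nat (Suc n) + s) * (of_nat (Suc n) - s))"
      using nz[of n] by (simp add: divide_simps del: of_nat_Suc)
    finally show ?thesis unfolding prod by (simp add: s_def power2_eq_square)
  qed
  have "Digamma (1 - s) - Digamma (1 + s) = of_real pi * cot (of_real pi * s) - 1 / s"
    using Digamma_reflection[OF notint] Digamma_plus1[OF s0] by (simp add: algebra_simps)
  also have "of_real pi * s = - \<i> * z / 2"
    by (simp add: s_def)
  also have "cot \<dots> = \<i> * (exp z + 1) / (exp z - 1)"
  proof -
    \<comment> \<open>In terms of exp(z/2), both sides become rational functions.\<close>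
    define y where "y = exp (z / 2)"
    have y: "y \<noteq> 0" "exp (- (z / 2)) = inverse y" "exp z = y\<^sup>2"
      by (auto simp: y_def exp_minus simp flip: exp_double)
    show ?thesis using e y(1)
      by (simp add: cot_def sin_exp_eq cos_exp_eq y y_def[symmetric] power2_eq_square divide_simps)
  qed
  finally have diff: "Digamma (1 - s) - Digamma (1 + s) = of_real pi * \<dots> - 1 / s" .
  have "z / (2 * pi * \<i>) * (Digamma (1 - s) - Digamma (1 + s)) = z / (exp z - 1) + z / 2 - 1"
    unfolding diff using e assms(1) by (simp add: s_def divide_simps) (simp add: algebra_simps)
  thus ?thesis
    using sums_mult[OF sums_Digamma_diff[OF \<open>1 + s \<noteq> 0\<close> \<open>1 - s \<noteq> 0\<close>], of "z / (2 * pi * \<i>)"]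
    by (simp only: summand)
qed

section \<open>Double series with a product majorant\<close>

lemma has_sum_product:
  fixes u :: "'a \<Rightarrow> real" and v :: "'b \<Rightarrow> real"
  assumes "(u has_sum a) A" "(v has_sum b) B"
      and "\<And>x. x \<in> A \<Longrightarrow> u x \<ge> 0" "\<And>y. y \<in> B \<Longrightarrow> v y \<ge> 0"
  shows "((\<lambda>(x, y). u x * v y) has_sum a * b) (A \<times> B)"
proof (rule has_sum_SigmaI)
  show b: "((\<lambda>y. case (x, y) of (x, y) \<Rightarrow> u x * v y) has_sum u x * b) B" for x
    using has_sum_cmult_right[OF assms(2)] by simp
  show a: "((\<lambda>x. u x * b) has_sum a * b) A"
    by (rule has_sum_cmult_left[OF assms(1)])
  show "(\<lambda>(x, y). u x * v y) summable_on A \<times> B"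
    using assms by (intro summable_on_SigmaI[OF b has_sum_imp_summable[OF a]]) auto
qed

lemma sums_imp_has_sum_nonneg:
  fixes u :: "nat \<Rightarrow> real"
  assumes "u sums a" "\<And>n. u n \<ge> 0"
  shows "(u has_sum a) UNIV"
  using assms by (intro norm_summable_imp_has_sum) (auto simp: sums_iff)

text \<open>The majorant makes the family absolutely summable over all pairs, so summing by rows or
  by columns gives the same unordered total, which the known sum of the rows identifies.\<close>

lemma sums_swap:
  fixes f :: "nat \<Rightarrow> nat \<Rightarrow> 'a :: banach"
  assumes "summable u" "summable v" "\<And>n. u n \<ge> 0" "\<And>k. v k \<ge> 0"
      and bound: "\<And>n k. norm (f n k) \<le> u n * v k"
      and rows: "\<And>n. f n sums r n" and cols: "\<And>k. (\<lambda>n. f n k) sums c k"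
      and S: "r sums S"
  shows "c sums S"
proof -
  have "((\<lambda>(n, k). u n * v k) has_sum suminf u * suminf v) (UNIV \<times> UNIV)"
    using assms by (intro has_sum_product sums_imp_has_sum_nonneg) auto
  hence "(\<lambda>p. norm (case p of (n, k) \<Rightarrow> f n k)) summable_on UNIV \<times> UNIV"
    using bound by (intro Infinite_Sum.abs_summable_on_comparison_test'[OF has_sum_imp_summable]) auto
  hence "(\<lambda>(n, k). f n k) summable_on UNIV \<times> UNIV"
    by (rule abs_summable_summable)
  then obtain T where T: "((\<lambda>(n, k). f n k) has_sum T) (UNIV \<times> UNIV)"
    by (auto simp: summable_on_def)
  hence T': "((\<lambda>(k, n). f n k) has_sum T) (UNIV \<times> UNIV)"
    by (subst (asm) has_sum_swap) auto
  have row: "(f n has_sum r n) UNIV" for n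
    using assms by (intro norm_summable_imp_has_sum[OF summable_comparison_test'[where g = "\<lambda>k. u n * v k"]])
      (auto intro: summable_mult)
  have col: "((\<lambda>n. f n k) has_sum c k) UNIV" for k
    using assms by (intro norm_summable_imp_has_sum[OF summable_comparison_test'[where g = "\<lambda>n. u n * v k"]])
      (auto intro: summable_mult2)
  have "r sums T"
    using has_sum_SigmaD[OF T, of r] row by (auto intro: has_sum_imp_sums)
  hence "T = S" using S by (rule sums_unique2)
  moreover have "c sums T"
    using has_sum_SigmaD[OF T', of c] col by (auto intro: has_sum_imp_sums)
  ultimately show ?thesis by simp
qed

section \<open>Euler's formula for even exponents and series over odd numbers\<close>

lemma summable_inverse_Suc_power:
  assumes "p \<ge> 2"
  shows "summable (\<lambda>n. 1 / real (Suc n) ^ p)"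
  using inverse_power_summable[OF assms, where 'a = real]
  by (subst (asm) summable_Suc_iff[symmetric]) (simp add: inverse_eq_divide)

text \<open>Euler's formula. Expanding each partial fraction of coth as a geometric series and
  interchanging the sums gives a power series for z/(exp z - 1); uniqueness of the generating
  sequence then identifies its coefficients.\<close>

lemma bernoulli_even:
  "bernoulli (2 * Suc j) =
     (- 1) ^ j * 2 * fact (2 * Suc j) / (2 * pi) ^ (2 * Suc j) * (\<Sum>n. 1 / real (Suc n) ^ (2 * Suc j))"
proof -
  define Z where "Z = (\<lambda>p. \<Sum>n. 1 / real (Suc n) ^ p)"
  \<comment> \<open>The candidate for the whole Bernoulli sequence; at n = 2(j+1) the exponent
    \<open>n div 2 - 1\<close> is j.\<close>
  define A where "A = (\<lambda>n. if n = 0 then 1 else if n = 1 then - 1 / 2 else if even n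
     then (- 1) ^ (n div 2 - 1) * 2 * fact n / (2 * pi) ^ n * Z n else 0)"
  have "bernoulli_gf A"
    unfolding bernoulli_gf_def
  proof (intro allI impI, elim conjE)
    fix z :: complex assume z: "z \<noteq> 0" "norm z < 2 * pi"
    define w where "w = z / (2 * pi)"
    have w: "norm w < 1" using z by (simp add: w_def norm_divide)
    have zw: "z = 2 * pi * w" by (simp add: w_def)
    \<comment> \<open>With N = n + 1, the n-th partial fraction is 2(w/N)^2 / (1 + (w/N)^2), and
      \<open>f n j\<close> is the j-th term of its geometric expansion.\<close>
    define f where "f = (\<lambda>n j. 2 * (- 1) ^ j * w ^ (2 * Suc j) / of_nat (Suc n) ^ (2 * Suc j))"
    have "(\<lambda>j. 2 * (- 1) ^ j * w ^ (2 * Suc j) * of_real (Z (2 * Suc j))) sums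
            (z / (exp z - 1) + z / 2 - 1)"
    proof (rule sums_swap[where f = f and u = "\<lambda>n. 1 / real (Suc n) ^ 2" and v = "\<lambda>j. 2 * norm w ^ (2 * Suc j)"
          and r = "\<lambda>n. 2 * z\<^sup>2 / (z\<^sup>2 + (2 * pi * real (Suc n))\<^sup>2)"])
      show "(\<lambda>n. 2 * z\<^sup>2 / (z\<^sup>2 + (2 * pi * real (Suc n))\<^sup>2)) sums (z / (exp z - 1) + z / 2 - 1)"
        by (rule coth_partial_fractions[OF z])
      show "f n sums (2 * z\<^sup>2 / (z\<^sup>2 + (2 * pi * real (Suc n))\<^sup>2))" for n
      proof -
        define q where "q = - (w / of_nat (Suc n))\<^sup>2"
        have "norm w / real (Suc n) < 1"
          using w by (simp add: field_simps)
        hence "norm (w / of_nat (Suc n)) < 1"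
          by (simp only: norm_divide norm_of_nat)
        hence q: "norm q < 1"
          by (simp add: q_def norm_power power_less_one_iff del: of_nat_Suc)
        have "(\<lambda>j. - 2 * q * q ^ j) sums (- 2 * q * (1 / (1 - q)))"
          by (intro sums_mult geometric_sums q)
        also have "(\<lambda>j. - 2 * q * q ^ j) = f n"
          by (simp add: f_def q_def fun_eq_iff power_minus' power_divide power_mult power_mult_distrib
              power2_eq_square power_minus[of "_ * _"] power_minus[of "_ / _"] mult_ac del: of_nat_Suc)
        also have "- 2 * q * (1 / (1 - q)) = 2 * z\<^sup>2 / (z\<^sup>2 + (2 * pi * real (Suc n))\<^sup>2)"
        proof -
          define N where "N = complex_of_nat (Suc n)"
          have N: "N \<noteq> 0" by (simp add: N_def del: of_nat_Suc)
          have "1 - q \<noteq> 0" using q by auto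
          moreover have "N\<^sup>2 + w\<^sup>2 = N\<^sup>2 * (1 - q)"
            using N unfolding q_def N_def[symmetric] by (simp add: field_simps)
          ultimately have "N\<^sup>2 + w\<^sup>2 \<noteq> 0" using N by simp
          moreover from this have "z\<^sup>2 + (2 * pi * N)\<^sup>2 \<noteq> 0"
            by (simp add: zw power_mult_distrib add_ac flip: distrib_left)
          moreover have "z\<^sup>2 + (2 * pi * real (Suc n))\<^sup>2 = z\<^sup>2 + (2 * pi * N)\<^sup>2"
            by (simp add: N_def)
          ultimately show ?thesis using N \<open>1 - q \<noteq> 0\<close>
            by (simp only: q_def N_def[symmetric]) (simp add: zw field_simps)
        qed
        finally show ?thesis .
      qed
      show "(\<lambda>n. f n j) sums (2 * (- 1) ^ j * w ^ (2 * Suc j) * of_real (Z (2 * Suc j)))" for j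
      proof -
        have "(\<lambda>n. 2 * (- 1) ^ j * w ^ (2 * Suc j) * of_real (1 / real (Suc n) ^ (2 * Suc j))) sums
           (2 * (- 1) ^ j * w ^ (2 * Suc j) * of_real (Z (2 * Suc j)))"
          unfolding Z_def
          by (intro sums_mult sums_of_real summable_sums summable_inverse_Suc_power) auto
        thus ?thesis by (simp add: f_def)
      qed
      show "summable (\<lambda>n. 1 / real (Suc n) ^ 2)"
        by (rule summable_inverse_Suc_power) auto
      have "summable (\<lambda>j. 2 * (norm w)\<^sup>2 * ((norm w)\<^sup>2) ^ j)"
        using w by (intro summable_mult summable_geometric) (simp add: power_less_one_iff)
      thus "summable (\<lambda>j. 2 * norm w ^ (2 * Suc j))"
        by (simp only: power_mult power_Suc mult.assoc)
      show "norm (f n j) \<le> 1 / real (Suc n) ^ 2 * (2 * norm w ^ (2 * Suc j))" for n j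
      proof -
        \<comment> \<open>Keeping only the square of n+1 separates the variables: the majorant is an
          inverse square times a geometric term, with |w| < 1.\<close>
        have "1 / real (Suc n) ^ (2 * Suc j) \<le> 1 / real (Suc n) ^ 2"
          by (intro divide_left_mono power_increasing) auto
        hence "2 * norm w ^ (2 * Suc j) * (1 / real (Suc n) ^ (2 * Suc j)) \<le>
                 2 * norm w ^ (2 * Suc j) * (1 / real (Suc n) ^ 2)"
          by (intro mult_left_mono) auto
        moreover have "norm (f n j) = 2 * norm w ^ (2 * Suc j) * (1 / real (Suc n) ^ (2 * Suc j))"
          unfolding f_def norm_divide norm_mult norm_power norm_of_nat by simp
        ultimately show ?thesis by (simp only: mult_ac)
      qed
    qed auto
    also have "(\<lambda>j. 2 * (- 1) ^ j * w ^ (2 * Suc j) * of_real (Z (2 * Suc j))) =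
        (\<lambda>j. of_real (A (2 * Suc j)) * z ^ (2 * Suc j) / fact (2 * Suc j))"
      by (simp add: A_def zw power_mult_distrib fun_eq_iff del: fact_Suc power_Suc power_Suc2)
    finally have "(\<lambda>j. (\<lambda>n. if even n \<and> n \<ge> 2 then of_real (A n) * z ^ n / fact n else 0) (2 * Suc j))
        sums (z / (exp z - 1) + z / 2 - 1)"
      by simp
    hence "(\<lambda>n. if even n \<and> n \<ge> 2 then of_real (A n) * z ^ n / fact n else 0) sums
             (z / (exp z - 1) + z / 2 - 1)"
    proof (subst (asm) sums_mono_reindex)
      fix n :: nat assume n: "n \<notin> range (\<lambda>j. 2 * Suc j)"
      have "n \<in> range (\<lambda>j. 2 * Suc j)" if "even n" "n \<ge> 2"
        using that by (intro image_eqI[of _ _ "n div 2 - 1"]) auto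
      with n show "(if even n \<and> n \<ge> 2 then of_real (A n) * z ^ n / fact n else 0) = 0"
        by auto
    qed (auto simp: strict_mono_def)
    \<comment> \<open>Restores the terms 1 and -z/2 that were moved to the other side in the coth
      expansion.\<close>
    from sums_add[OF sums_add[OF sums_single[of 0 "\<lambda>_. 1"] sums_single[of 1 "\<lambda>_. - z / 2"]] this]
    have "(\<lambda>n. (if n = 0 then 1 else 0) + (if n = 1 then - z / 2 else 0) +
            (if even n \<and> n \<ge> 2 then of_real (A n) * z ^ n / fact n else 0)) sums (z / (exp z - 1))"
      by simp
    also have "(\<lambda>n. (if n = 0 then 1 else 0) + (if n = 1 then - z / 2 else 0) +
            (if even n \<and> n \<ge> 2 then of_real (A n) * z ^ n / fact n else 0)) =
        (\<lambda>n. of_real (A n) * z ^ n / fact n)"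
      by (rule ext) (auto simp: A_def)
    finally show "(\<lambda>n. of_real (A n) * z ^ n / fact n) sums (z / (exp z - 1))" .
  qed
  hence "bernoulli = A"
    using bernoulli_gf_bernoulli bernoulli_gf_unique by blast
  hence "bernoulli (2 * Suc j) = A (2 * Suc j)"
    by simp
  thus ?thesis
    by (simp add: A_def Z_def del: power_Suc fact_Suc mult_Suc_right)
qed

text \<open>Remove from the full series its even-numbered terms, which form 2^(-p) times the full
  series.\<close>

lemma sums_odd_powers:
  assumes "p \<ge> 2"
  shows "(\<lambda>n. 1 / (2 * real n + 1) ^ p) sums ((1 - 1 / 2 ^ p) * (\<Sum>n. 1 / real (Suc n) ^ p))"
proof -
  let ?Z = "\<Sum>n. 1 / real (Suc n) ^ p"
  have Z: "(\<lambda>n. 1 / real (Suc n) ^ p) sums ?Z"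
    by (intro summable_sums summable_inverse_Suc_power assms)
  \<comment> \<open>Group the terms in pairs, so that each pair holds one odd and one even
    base.\<close>
  have "{n * 2..<n * 2 + 2} = {n * 2, n * 2 + 1}" for n :: nat by auto
  hence "(\<lambda>n. 1 / (2 * real n + 1) ^ p + 1 / (2 * real n + 2) ^ p) sums ?Z"
    using sums_group[OF Z, of 2] by (simp add: mult_ac add_ac)
  moreover have "(\<lambda>n. 1 / 2 ^ p * (1 / real (Suc n) ^ p)) sums (1 / 2 ^ p * ?Z)"
    by (intro sums_mult Z)
  ultimately have "(\<lambda>n. 1 / (2 * real n + 1) ^ p + 1 / (2 * real n + 2) ^ p - 1 / 2 ^ p * (1 / real (Suc n) ^ p))
      sums (?Z - 1 / 2 ^ p * ?Z)"
    by (rule sums_diff)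
  moreover have "1 / (2 * real n + 2) ^ p = 1 / 2 ^ p * (1 / real (Suc n) ^ p)" for n
  proof -
    have "2 * real n + 2 = 2 * real (Suc n)" by simp
    thus ?thesis by (simp only: power_mult_distrib) simp
  qed
  ultimately show ?thesis by (simp add: algebra_simps)
qed

lemma sums_odd_even_powers:
  "(\<lambda>n. 1 / (2 * real n + 1) ^ (2 * Suc j)) sums
     ((- 1) ^ j * pi ^ (2 * Suc j) * (2 ^ (2 * Suc j) - 1) * bernoulli (2 * Suc j) / (2 * fact (2 * Suc j)))"
proof -
  let ?p = "2 * Suc j"
  have "(1 - 1 / 2 ^ ?p) * (\<Sum>n. 1 / real (Suc n) ^ ?p) =
      (- 1) ^ j * pi ^ ?p * (2 ^ ?p - 1) * bernoulli ?p / (2 * fact ?p)"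
    unfolding bernoulli_even by (simp add: field_simps power_mult_distrib del: fact_Suc power_Suc)
  thus ?thesis using sums_odd_powers[of ?p] by (simp del: fact_Suc power_Suc)
qed

section \<open>Symmetrisation and the tanh series over odd numbers\<close>

text \<open>Over a common denominator the numerator is a^N + b^N. For odd N this is minus the
  difference of powers (-b)^N - a^N, whose factor a + b cancels the mixed denominator; each
  remaining term separates a from b.\<close>

lemma symmetrised_kernel:
  fixes a b :: real
  assumes "a > 0" "b > 0" "odd N"
  shows "1 / (a ^ N * (a + b)) + 1 / (b ^ N * (b + a)) =
           (\<Sum>i<N. (- 1) ^ i * (1 / a ^ Suc i * (1 / b ^ (N - i))))"
proof -
  have "(- b) ^ N - a ^ N = (- b - a) * (\<Sum>i<N. a ^ (N - Suc i) * (- b) ^ i)"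
    by (rule power_diff_sumr2)
  hence *: "a ^ N + b ^ N = (a + b) * (\<Sum>i<N. a ^ (N - Suc i) * (- b) ^ i)"
    using assms(3) by (simp add: algebra_simps)
  have "1 / (a ^ N * (a + b)) + 1 / (b ^ N * (b + a)) = (a ^ N + b ^ N) / ((a + b) * (a ^ N * b ^ N))"
    using assms by (simp add: divide_simps) (simp add: algebra_simps)
  also have "\<dots> = (\<Sum>i<N. a ^ (N - Suc i) * (- b) ^ i / (a ^ N * b ^ N))"
    unfolding * using assms by (simp add: sum_divide_distrib)
  also have "\<dots> = (\<Sum>i<N. (- 1) ^ i * (1 / a ^ Suc i * (1 / b ^ (N - i))))"
  proof (rule sum.cong)
    fix i assume i: "i \<in> {..<N}"
    hence "a ^ N = a ^ (N - Suc i) * a ^ Suc i" "b ^ N = b ^ i * b ^ (N - i)"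
      by (auto simp del: power_Suc simp flip: power_add)
    thus "a ^ (N - Suc i) * (- b) ^ i / (a ^ N * b ^ N) = (- 1) ^ i * (1 / a ^ Suc i * (1 / b ^ (N - i)))"
      using assms by (simp add: power_minus[of b])
  qed auto
  finally show ?thesis .
qed

lemma has_sum_sum:
  fixes f :: "'i \<Rightarrow> 'a \<Rightarrow> 'b :: topological_comm_monoid_add"
  assumes "\<And>i. i \<in> I \<Longrightarrow> (f i has_sum s i) A"
  shows "((\<lambda>x. \<Sum>i\<in>I. f i x) has_sum (\<Sum>i\<in>I. s i)) A"
  using assms by (induction I rule: infinite_finite_induct) (auto intro: has_sum_add)

lemma sums_tanh_odd:
  "(\<lambda>n. tanh (pi * (2 * real n + 1) / 2) / (2 * real n + 1) ^ (4 * m + 3)) sums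
     (- (pi ^ (4 * m + 3) / 2) *
        (\<Sum>j = 1..2 * m + 1. (- 1) ^ j * bernoulli (2 * j) * bernoulli (4 * m + 4 - 2 * j)
                / (fact (2 * j) * fact (4 * m + 4 - 2 * j))
                * (2 ^ (2 * j) - 1) * (2 ^ (4 * m + 4 - 2 * j) - 1)))"
proof -
  define x where "x = (\<lambda>n. 2 * real n + 1)"
  have x: "x n \<ge> 1" for n by (simp add: x_def)
  hence x0: "x n > 0" for n using less_le_trans zero_less_one by blast
  define N where "N = 2 * m + 1"
  \<comment> \<open>Summing over k first produces the tanh series up to the factor pi/4, while
    adding the transposed family produces separable terms.\<close>
  define F where "F = (\<lambda>(n, k). 1 / (((x n)\<^sup>2) ^ N * ((x n)\<^sup>2 + (x k)\<^sup>2)))"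
  define L where "L = (\<lambda>j. (- 1) ^ j * pi ^ (2 * Suc j) * (2 ^ (2 * Suc j) - 1) *
                              bernoulli (2 * Suc j) / (2 * fact (2 * Suc j)))"
  have L: "((\<lambda>n. 1 / ((x n)\<^sup>2) ^ Suc j) has_sum L j) UNIV" for j
    using sums_odd_even_powers[of j] unfolding power_mult x_def L_def
    by (intro sums_imp_has_sum_nonneg) auto
  have LL: "((\<lambda>(n, k). 1 / ((x n)\<^sup>2) ^ Suc i * (1 / ((x k)\<^sup>2) ^ Suc j)) has_sum L i * L j) (UNIV \<times> UNIV)"
    for i j
    by (intro has_sum_product L) auto
  \<comment> \<open>Since \<open>x n\<close> and N are at least 1, \<open>F\<close> is dominated by
    a product of two inverse squares, the case \<open>LL\<close> with both indices 0.\<close>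
  have "F summable_on UNIV \<times> UNIV"
  proof (rule summable_on_comparison_test[OF has_sum_imp_summable[OF LL[of 0 0]]], safe)
    fix n k :: nat
    have "(x n)\<^sup>2 \<le> ((x n)\<^sup>2) ^ N"
      using x[of n] by (intro self_le_power) (auto simp: N_def)
    moreover have "(x k)\<^sup>2 \<le> (x n)\<^sup>2 + (x k)\<^sup>2" by simp
    ultimately have "(x n)\<^sup>2 * (x k)\<^sup>2 \<le> ((x n)\<^sup>2) ^ N * ((x n)\<^sup>2 + (x k)\<^sup>2)"
      by (intro mult_mono) auto
    hence "F (n, k) \<le> 1 / ((x n)\<^sup>2 * (x k)\<^sup>2)"
      unfolding F_def using x0[of n] x0[of k] by (auto intro!: divide_left_mono mult_pos_pos add_pos_pos)
    thus "F (n, k) \<le> 1 / (x n)\<^sup>2 ^ Suc 0 * (1 / (x k)\<^sup>2 ^ Suc 0)" by simp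
  qed (auto simp: F_def)
  then obtain T where T: "(F has_sum T) (UNIV \<times> UNIV)"
    by (auto simp: summable_on_def)
  \<comment> \<open>The transposed family has the same total, so the symmetrised one sums to twice
    \<open>T\<close>. The exponent N - i is written \<open>Suc (N - Suc i)\<close> to fit the
    indexing of \<open>L\<close>.\<close>
  have T_eq: "T + T = (\<Sum>i<N. (- 1) ^ i * (L i * L (N - Suc i)))"
  proof (rule has_sum_unique)
    have "((\<lambda>(k, n). F (n, k)) has_sum T) (UNIV \<times> UNIV)"
      by (rule has_sum_swap[THEN iffD1, OF T])
    from has_sum_add[OF T this]
    show "((\<lambda>p. F p + (case p of (k, n) \<Rightarrow> F (n, k))) has_sum (T + T)) (UNIV \<times> UNIV)" .
    have "((\<lambda>p. \<Sum>i<N. (- 1) ^ i * (case p of (n, k) \<Rightarrow> 1 / ((x n)\<^sup>2) ^ Suc i * (1 / ((x k)\<^sup>2) ^ Suc (N - Suc i))))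
        has_sum (\<Sum>i<N. (- 1) ^ i * (L i * L (N - Suc i)))) (UNIV \<times> UNIV)"
      by (intro has_sum_sum has_sum_cmult_right LL)
    also have "(\<lambda>p. \<Sum>i<N. (- 1) ^ i * (case p of (n, k) \<Rightarrow> 1 / ((x n)\<^sup>2) ^ Suc i * (1 / ((x k)\<^sup>2) ^ Suc (N - Suc i))))
      = (\<lambda>p. F p + (case p of (k, n) \<Rightarrow> F (n, k)))"
    proof
      fix p :: "nat \<times> nat"
      obtain n k where p: "p = (n, k)" by fastforce
      have "F (n, k) + F (k, n) =
          (\<Sum>i<N. (- 1) ^ i * (1 / ((x n)\<^sup>2) ^ Suc i * (1 / ((x k)\<^sup>2) ^ (N - i))))"
        unfolding F_def prod.case using x0[of n] x0[of k]
        by (intro symmetrised_kernel) (auto simp: N_def)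
      also have "\<dots> = (\<Sum>i<N. (- 1) ^ i * (1 / ((x n)\<^sup>2) ^ Suc i * (1 / ((x k)\<^sup>2) ^ Suc (N - Suc i))))"
        by (intro sum.cong) (auto simp: Suc_diff_Suc simp del: power_Suc)
      finally show "(\<Sum>i<N. (- 1) ^ i * (case p of (n, k) \<Rightarrow> 1 / ((x n)\<^sup>2) ^ Suc i * (1 / ((x k)\<^sup>2) ^ Suc (N - Suc i))))
        = F p + (case p of (k, n) \<Rightarrow> F (n, k))" by (simp add: p)
    qed
    finally show "((\<lambda>p. F p + (case p of (k, n) \<Rightarrow> F (n, k))) has_sum
        (\<Sum>i<N. (- 1) ^ i * (L i * L (N - Suc i)))) (UNIV \<times> UNIV)" .
  qed
  define c where "c = (\<lambda>j. (- 1) ^ j * bernoulli (2 * j) * bernoulli (4 * m + 4 - 2 * j)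
                / (fact (2 * j) * fact (4 * m + 4 - 2 * j))
                * (2 ^ (2 * j) - 1) * (2 ^ (4 * m + 4 - 2 * j) - 1))"
  \<comment> \<open>The signs inside the two values of \<open>L\<close> cancel because their indices
    add up to 2m. Passing to the index j = i + 1 turns (-1)^i into -(-1)^j, hence the minus sign;
    the 4 collects the two denominators 2.\<close>
  have "(- 1) ^ i * (L i * L (N - Suc i)) = - (pi ^ (4 * m + 4) / 4) * c (Suc i)" if "i < N" for i
  proof -
    define l where "l = N - Suc i"
    have l: "4 * m + 4 - 2 * Suc i = 2 * Suc l" "4 * m + 4 = 2 * Suc i + 2 * Suc l" "i + l = 2 * m"
      using that by (auto simp: l_def N_def)
    have "(- 1 :: real) ^ i * (- 1) ^ l = 1"
      by (simp add: l(3) flip: power_add)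
    hence "(- 1) ^ i * (L i * L l) = pi ^ (4 * m + 4) / 4 * ((- 1) ^ i * bernoulli (2 * Suc i) * bernoulli (2 * Suc l)
                / (fact (2 * Suc i) * fact (2 * Suc l)) * (2 ^ (2 * Suc i) - 1) * (2 ^ (2 * Suc l) - 1))"
      unfolding L_def l(2) power_add[of pi] by (simp del: power_Suc fact_Suc mult_Suc_right)
    thus ?thesis unfolding c_def l(1) l_def[symmetric] by (simp del: fact_Suc mult_Suc_right)
  qed
  hence "T + T = - (pi ^ (4 * m + 4) / 4) * (\<Sum>i<N. c (Suc i))"
    unfolding T_eq sum_distrib_left by (intro sum.cong) auto
  also have "(\<Sum>i<N. c (Suc i)) = (\<Sum>j=1..2*m+1. c j)"
    by (rule sum.reindex_bij_witness[of _ "\<lambda>j. j - 1" Suc]) (auto simp: N_def)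
  finally have T_val: "T * (4 / pi) = - (pi ^ (4 * m + 3) / 2) * (\<Sum>j=1..2*m+1. c j)"
    by (simp add: field_simps power_add eval_nat_numeral)
  \<comment> \<open>For fixed n the inner sum is the tanh expansion at x = \<open>x n\<close>;
    multiplying by 4/pi afterwards removes its constant.\<close>
  have "((\<lambda>k. F (n, k)) has_sum (1 / ((x n)\<^sup>2) ^ N * (pi * tanh (pi * x n / 2) / (4 * x n)))) UNIV" for n
  proof (rule sums_imp_has_sum_nonneg)
    have "(\<lambda>k. 1 / ((x k)\<^sup>2 + (x n)\<^sup>2)) sums (pi * tanh (pi * x n / 2) / (4 * x n))"
      using tanh_partial_fractions[of "x n"] x0[of n] by (simp add: x_def)
    from sums_mult[OF this, of "1 / ((x n)\<^sup>2) ^ N"]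
    show "(\<lambda>k. F (n, k)) sums (1 / ((x n)\<^sup>2) ^ N * (pi * tanh (pi * x n / 2) / (4 * x n)))"
      by (simp add: F_def add_ac)
  qed (auto simp: F_def)
  from has_sum_SigmaD[OF T this]
  have "(\<lambda>n. 1 / ((x n)\<^sup>2) ^ N * (pi * tanh (pi * x n / 2) / (4 * x n))) sums T"
    by (intro has_sum_imp_sums)
  hence "(\<lambda>n. 1 / ((x n)\<^sup>2) ^ N * (pi * tanh (pi * x n / 2) / (4 * x n)) * (4 / pi)) sums (T * (4 / pi))"
    by (rule sums_mult2)
  also have "(\<lambda>n. 1 / ((x n)\<^sup>2) ^ N * (pi * tanh (pi * x n / 2) / (4 * x n)) * (4 / pi)) =
      (\<lambda>n. tanh (pi * x n / 2) / x n ^ (4 * m + 3))"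
  proof
    fix n
    have "4 * m + 3 = Suc (2 * N)"
      by (simp add: N_def)
    hence "x n ^ (4 * m + 3) = ((x n)\<^sup>2) ^ N * x n"
      by (simp only: power_Suc2 power_mult)
    thus "1 / ((x n)\<^sup>2) ^ N * (pi * tanh (pi * x n / 2) / (4 * x n)) * (4 / pi) =
        tanh (pi * x n / 2) / x n ^ (4 * m + 3)" by simp
  qed
  finally show ?thesis unfolding T_val unfolding x_def c_def .
qed

section \<open>Zeta at integers and the exponential series\<close>

lemma zeta_of_nat:
  assumes "p \<ge> 2"
  shows "zeta (of_nat p) = of_real (\<Sum>n. 1 / real (Suc n) ^ p)"
proof -
  have "of_nat (Suc n) powr - of_nat p = complex_of_real (1 / real (Suc n) ^ p)" for n
    by (simp add: powr_minus powr_nat' inverse_eq_divide del: of_nat_Suc)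
  hence "zeta_series (of_nat p) = (\<Sum>n. of_real (1 / real (Suc n) ^ p))"
    by (simp only: zeta_series_def)
  also have "\<dots> = of_real (\<Sum>n. 1 / real (Suc n) ^ p)"
    by (rule suminf_of_real[symmetric, OF summable_inverse_Suc_power[OF assms]])
  finally show ?thesis using assms by (simp add: zeta_def)
qed

theorem corollary4p4:
  fixes m :: nat
  shows "zeta (of_nat (4 * m + 3))
       - of_real (2 / (1 - 2 powi (- 4 * int m - 3)) *
           (\<Sum>j. (2 * real (Suc j) - 1) powi (- 4 * int m - 3)
                  / (exp ((2 * real (Suc j) - 1) * pi) + 1)))
     = of_real (- (2 ^ (4 * m + 2) * pi ^ (4 * m + 3) / (2 ^ (4 * m + 3) - 1)) *
           (\<Sum>j = 1..2 * m + 1.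
              (- 1) ^ j * bernoulli (2 * j) * bernoulli (4 * m + 4 - 2 * j)
                / (fact (2 * j) * fact (4 * m + 4 - 2 * j))
                * (2 ^ (2 * j) - 1) * (2 ^ (4 * m + 4 - 2 * j) - 1)))"
proof -
  define p where "p = 4 * m + 3"
  define Z where "Z = (\<Sum>n. 1 / real (Suc n) ^ p)"
  define S where "S = (\<Sum>j = 1..2 * m + 1.
              (- 1) ^ j * bernoulli (2 * j) * bernoulli (4 * m + 4 - 2 * j)
                / (fact (2 * j) * fact (4 * m + 4 - 2 * j))
                * (2 ^ (2 * j) - 1) * (2 ^ (4 * m + 4 - 2 * j) - 1))"
  define E where "E = (\<lambda>j. (2 * real (Suc j) - 1) powi (- 4 * int m - 3) / (exp ((2 * real (Suc j) - 1) * pi) + 1))"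
  \<comment> \<open>The ratio of the series over odd numbers to zeta(p).\<close>
  define q where "q = 1 - 1 / (2 :: real) ^ p"
  have p: "p \<ge> 2" by (simp add: p_def)
  have powi: "y powi (- 4 * int m - 3) = 1 / y ^ p" for y :: real
  proof -
    have "- 4 * int m - 3 = - int p" by (simp add: p_def)
    thus ?thesis by (simp only: power_int_minus power_int_of_nat inverse_eq_divide)
  qed
  have q: "q = (2 ^ p - 1) / 2 ^ p" "q > 0"
    using one_less_power[of "2 :: real" p] p by (auto simp: q_def field_simps)
  have tanh: "1 - tanh (pi * y / 2) = 2 / (exp (y * pi) + 1)" for y :: real
  proof -
    have "exp (y * pi) + 1 > 0" by (simp add: add_pos_pos)
    thus ?thesis
      by (simp add: tanh_real_altdef exp_minus mult.commute[of pi] divide_simps)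
  qed
  \<comment> \<open>By the identity for 1 - tanh, subtracting the tanh series from the odd part of
    zeta(p) leaves twice the exponential series. This also proves that series convergent, so its
    \<open>suminf\<close> is a genuine value.\<close>
  have "(\<lambda>n. 1 / (2 * real n + 1) ^ p - tanh (pi * (2 * real n + 1) / 2) / (2 * real n + 1) ^ p)
      sums (q * Z - - (pi ^ p / 2) * S)"
    using sums_diff[OF sums_odd_powers[OF p] sums_tanh_odd[of m, folded p_def]]
    unfolding q_def Z_def S_def .
  also have "(\<lambda>n. 1 / (2 * real n + 1) ^ p - tanh (pi * (2 * real n + 1) / 2) / (2 * real n + 1) ^ p) =
     (\<lambda>n. 2 * E n)"
  proof
    fix n
    define y where "y = 2 * real n + 1"
    have y: "2 * real (Suc n) - 1 = y" by (simp add: y_def)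
    have "1 / y ^ p - tanh (pi * y / 2) / y ^ p = (1 - tanh (pi * y / 2)) / y ^ p"
      by (simp add: diff_divide_distrib)
    thus "1 / (2 * real n + 1) ^ p - tanh (pi * (2 * real n + 1) / 2) / (2 * real n + 1) ^ p =
       2 * E n"
      unfolding E_def y powi y_def[symmetric] tanh by simp
  qed
  finally have "(\<Sum>j. E j) = (q * Z + pi ^ p / 2 * S) / 2"
    using sums_divide[of "\<lambda>n. 2 * E n" _ 2] by (simp add: sums_iff)
  hence "Z - 2 / q * (\<Sum>j. E j) = - (pi ^ p / 2) * S / q"
    using q(2) by (simp add: field_simps)
  \<comment> \<open>Here 1/(2q) = 2^(p-1)/(2^p - 1) and p - 1 = 4m + 2.\<close>
  also have "\<dots> = - (2 ^ (4 * m + 2) * pi ^ p / (2 ^ p - 1)) * S"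
  proof -
    have "(2 :: real) ^ p = 2 * 2 ^ (4 * m + 2)" by (simp add: p_def eval_nat_numeral)
    thus ?thesis by (simp add: q(1))
  qed
  finally show ?thesis
    unfolding p_def[symmetric] zeta_of_nat[OF p] Z_def[symmetric] S_def[symmetric]
      powi[of 2] q_def[symmetric] E_def[symmetric] by (simp only: flip: of_real_diff)
qed

end
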